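(* Let $r=[m_1,m_2,\dots,m_k]$ be a rational number with $0<r<1$, and let $CS(r)=(\!(S_1,S_2,S_1,S_2)\!)$ be a decomposition such that: (a) each $S_i$ is symmetric, i.e., equal to its reverse ($S_1$ is empty if $k=1$); (b) each $S_i$ occurs only twice in the cyclic sequence $CS(r)$; (c) $S_1$ begins and ends with $m_1+1$; (d) $S_2$ begins and ends with $m_1$. Suppose that a rational number $s$ with $0<s\le1$ has a continued fraction expansion $s=[l_1,\dots,l_t]$, where $t\ge1$, $(l_1,\dots,l_t)\in(\mathbb{Z}_+)^t$, and $l_t\ge2$ unless $t=1$. Suppose also that $CS(s)$ satisfies the following condition: (i) If $k=1$, namely $r=[m_1]$, then $CS(s)$ contains a term bigger than or equal to $m_1$. (ii) If $k\ge2$, then $CS(s)$ contains $(S_1,S_2)$ or $(S_2,S_1)$ as a subsequence. Then the following hold. (1) $t\ge k$. (2) $l_i=m_i$ for each $i=1,\dots,k-1$. (3) Either $l_k\ge m_k$, or both $l_k=m_k-1$ and $t>k$.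
   Context: **Continued fractions.** $[m_1,\dots,m_k]=\cfrac{1}{m_1+\cfrac{1}{m_2+\cdots+\cfrac{1}{m_k}}}$. Every rational $r$ with $0<r\le1$ is written $r=[m_1,\dots,m_k]$ with $k\ge1$, $m_i$ positive integers, and $m_k\ge2$ unless $k=1$. **The word $u_r$.** For a positive rational number $r=q/p$ with $p,q$ relatively prime positive integers, set $\epsilon_i=(-1)^{\lfloor iq/p\rfloor}$ and define a word in the free generators $a,b$ by: - if $p$ is odd, $u_{q/p}=a\,\hat u_{q/p}\,b^{(-1)^q}\,\hat u_{q/p}^{-1}$ with $\hat u_{q/p}=b^{\epsilon_1}a^{\epsilon_2}\cdots b^{\epsilon_{p-2}}a^{\epsilon_{p-1}}$ (empty if $p=1$); - if $p$ is even, $u_{q/p}=a\,\hat u_{q/p}\,a^{-1}\,\hat u_{q/p}^{-1}$ with $\hat u_{q/p}=b^{\epsilon_1}a^{\epsilon_2}\cdots a^{\epsilon_{p-2}}b^{\epsilon_{p-1}}$. **Cyclic $S$-sequence.** For a cyclically reduced word $v$ in $\{a,b\}$, let $(v)$ be the cyclic word consisting of all its cyclic permutations. Decompose $(v)\equiv(v_1v_2\cdots v_n)$ into maximal blocks such that all letters in each $v_i$ have exponents of one sign and all letters in $v_{i+1}$ have exponents of the opposite sign (indices mod $n$). Then $CS(v):=(\!(|v_1|,|v_2|,\dots,|v_n|)\!)$, where $|\cdot|$ is word length and double parentheses mean the sequence is considered modulo cyclic permutations. For rational $0<r\le1$, put $CS(r):=CS(u_r)$. **Conventions.** $(\!(S_1,S_2,S_1,S_2)\!)$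 denotes the cyclic sequence represented by the concatenation of the finite sequences $S_1,S_2,S_1,S_2$, and $(S_i,S_j)$ denotes concatenation. An occurrence of a nonempty finite sequence in a cyclic sequence is a position (modulo the length of the cyclic sequence) from which the consecutive terms, read cyclically, agree with the given sequence; "occurs only twice" means there are exactly two such positions. When $k=1$, $S_1$ is empty and conditions (b), (c) for $S_1$ are vacuous. A cyclic sequence contains a finite sequence $T$ as a subsequence if some linear sequence representing the cyclic sequence has $T$ as a block of consecutive terms. A decomposition of $CS(r)$ with properties (a)–(d) is known to exist. *)

theory Defs
  imports Complex_Main "HOL-Library.Sublist"
begin

section \<open>Continued fractions\<close>

text \<open>The value of \<open>[m\<^sub>1, \<dots>, m\<^sub>k]\<close>; the empty list only ends the recursion.\<close>

fun cfrac :: "nat list \<Rightarrow> rat" where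
  "cfrac [] = 0"
| "cfrac (m # ms) = 1 / (of_nat m + cfrac ms)"

definition cfrac_expansion :: "rat \<Rightarrow> nat list \<Rightarrow> bool" where
  "cfrac_expansion r ms \<longleftrightarrow>
     length ms \<ge> 1 \<and> (\<forall>m \<in> set ms. m > 0) \<and> (length ms \<noteq> 1 \<longrightarrow> last ms \<ge> 2) \<and> r = cfrac ms"


section \<open>Words in two generators\<close>

datatype gen = Gen_a | Gen_b

text \<open>A letter is a generator together with its exponent; only the exponents \<open>1\<close> and \<open>-1\<close> are used.\<close>

type_synonym word = "(gen \<times> int) list"

definition word_inv :: "word \<Rightarrow> word" where
  "word_inv w = rev (map (\<lambda>(g, e). (g, - e)) w)"

definition rat_num :: "rat \<Rightarrow> nat" where
  "rat_num r = nat (fst (quotient_of r))"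

definition rat_den :: "rat \<Rightarrow> nat" where
  "rat_den r = nat (snd (quotient_of r))"

definition eps :: "rat \<Rightarrow> nat \<Rightarrow> int" where
  "eps r i = (-1) ^ ((i * rat_num r) div rat_den r)"

text \<open>For both parities of the denominator \<open>p\<close>, the word is
  \<open>b\<^bsup>\<epsilon>\<^sub>1\<^esup> a\<^bsup>\<epsilon>\<^sub>2\<^esup> b\<^bsup>\<epsilon>\<^sub>3\<^esup> \<dots>\<close> with \<open>p - 1\<close> letters,
  so it ends in \<open>a\<close> if \<open>p\<close> is odd and in \<open>b\<close> if \<open>p\<close> is even.\<close>

definition u_hat :: "rat \<Rightarrow> word" where
  "u_hat r = map (\<lambda>i. (if odd i then Gen_b else Gen_a, eps r i)) [1..<rat_den r]"

definition u_word :: "rat \<Rightarrow> word" where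
  "u_word r =
     (if odd (rat_den r)
      then [(Gen_a, 1)] @ u_hat r @ [(Gen_b, (-1) ^ rat_num r)] @ word_inv (u_hat r)
      else [(Gen_a, 1)] @ u_hat r @ [(Gen_a, -1)] @ word_inv (u_hat r))"


section \<open>Cyclic sequences\<close>

text \<open>A cyclic sequence (or cyclic word) is the set of all its linear representatives.\<close>

definition cyclic :: "'a list \<Rightarrow> 'a list set" where
  "cyclic xs = {rotate n xs | n. True}"

text \<open>Positions, modulo the length of \<open>xs\<close>, at which \<open>T\<close> can be read off cyclically.\<close>

definition cyclic_occurrences :: "'a list \<Rightarrow> 'a list \<Rightarrow> nat set" where
  "cyclic_occurrences T xs =
     {i. i < length xs \<and> (\<forall>j < length T. xs ! ((i + j) mod length xs) = T ! j)}"

text \<open>The number of occurrences does not depend on the representative, see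
  \<open>card_cyclic_occurrences_rotate\<close> below.\<close>

definition occurs_exactly :: "nat \<Rightarrow> 'a list \<Rightarrow> 'a list set \<Rightarrow> bool" where
  "occurs_exactly n T C \<longleftrightarrow> (\<forall>xs \<in> C. card (cyclic_occurrences T xs) = n)"

definition cyclic_contains :: "'a list set \<Rightarrow> 'a list \<Rightarrow> bool" where
  "cyclic_contains C T \<longleftrightarrow> (\<exists>xs \<in> C. sublist T xs)"

lemma card_cyclic_occurrences_rotate:
  "card (cyclic_occurrences T (rotate m xs)) = card (cyclic_occurrences T xs)"
proof -
  have one: "card (cyclic_occurrences T (rotate k ys)) \<le> card (cyclic_occurrences T ys)"
    for k and ys :: "'a list"
  proof (cases "ys = []")
    case True
    then show ?thesis by simp
  next
    case False
    let ?n = "length ys"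
    let ?f = "\<lambda>i. (k + i) mod ?n"
    have n: "?n > 0" using False by simp
    show ?thesis
    proof (rule card_inj_on_le[where f = ?f])
      show "inj_on ?f (cyclic_occurrences T (rotate k ys))"
      proof (rule inj_onI)
        fix x y
        assume x: "x \<in> cyclic_occurrences T (rotate k ys)"
          and y: "y \<in> cyclic_occurrences T (rotate k ys)"
          and e: "(k + x) mod ?n = (k + y) mod ?n"
        have lt: "x < ?n" "y < ?n" using x y by (auto simp: cyclic_occurrences_def)
        show "x = y"
        proof (cases "x \<le> y")
          case True
          then have "?n dvd y - x" using e mod_eq_dvd_iff_nat[of "k + x" "k + y" ?n] by simp
          with lt True show ?thesis by (auto dest: dvd_imp_le)
        next
          case False
          then have "?n dvd x - y" using e mod_eq_dvd_iff_nat[of "k + y" "k + x" ?n] by simp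
          with lt False show ?thesis by (auto dest: dvd_imp_le)
        qed
      qed
      show "?f ` cyclic_occurrences T (rotate k ys) \<subseteq> cyclic_occurrences T ys"
      proof
        fix z
        assume "z \<in> ?f ` cyclic_occurrences T (rotate k ys)"
        then obtain i where i: "i < ?n" and z: "z = (k + i) mod ?n"
          and r: "\<forall>j < length T. rotate k ys ! ((i + j) mod ?n) = T ! j"
          by (auto simp: cyclic_occurrences_def)
        have "ys ! ((z + j) mod ?n) = T ! j" if "j < length T" for j
        proof -
          have "rotate k ys ! ((i + j) mod ?n) = ys ! ((k + (i + j) mod ?n) mod ?n)"
            using n by (simp add: nth_rotate)
          also have "(k + (i + j) mod ?n) mod ?n = (z + j) mod ?n"
            by (simp add: z mod_simps add.assoc)
          finally show ?thesis using r that by simp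
        qed
        then show "z \<in> cyclic_occurrences T ys"
          using n by (simp add: cyclic_occurrences_def z)
      qed
      show "finite (cyclic_occurrences T ys)"
        by (simp add: cyclic_occurrences_def)
    qed
  qed
  have inverse: "\<exists>k. rotate k (rotate m xs) = xs"
  proof (cases "xs = []")
    case False
    have "(length xs - m mod length xs + m) mod length xs = 0"
      using False by (metis add.commute le_add_diff_inverse length_greater_0_conv less_imp_le
          mod_add_left_eq mod_less_divisor mod_self)
    then show ?thesis
      by (intro exI[of _ "length xs - m mod length xs"]) (simp add: rotate_rotate rotate_id)
  qed simp
  then obtain k where "rotate k (rotate m xs) = xs" by blast
  with one[of m xs] one[of k "rotate m xs"] show ?thesis by simp
qed


section \<open>Cyclic S-sequences\<close>

text \<open>\<open>vs\<close> is a decomposition into maximal blocks of constant sign of the word \<open>concat vs\<close>, read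
  cyclically.  The indices are taken modulo the number of blocks.\<close>

definition sign_blocks :: "word list \<Rightarrow> bool" where
  "sign_blocks vs \<longleftrightarrow>
     (\<forall>v \<in> set vs. v \<noteq> []) \<and>
     (\<forall>v \<in> set vs. \<forall>x \<in> set v. \<forall>y \<in> set v. snd x = snd y) \<and>
     (\<forall>i < length vs. \<forall>x \<in> set (vs ! i). \<forall>y \<in> set (vs ! (Suc i mod length vs)). snd y = - snd x)"

text \<open>The block decompositions of the cyclic word \<open>(v)\<close> differ only by a cyclic permutation of
  the blocks, so this set is again a cyclic sequence, given by its representatives  (it is empty
  if \<open>v\<close> is a nonempty word whose letters all have the same sign).\<close>

definition CS_word :: "word \<Rightarrow> nat list set" where
  "CS_word v = {map length vs | vs. concat vs \<in> cyclic v \<and> sign_blocks vs}"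

definition CS :: "rat \<Rightarrow> nat list set" where
  "CS r = CS_word (u_word r)"

end

theory Submission
  imports Defs
begin

text \<open>Write \<open>r = q/p\<close> in lowest terms and put \<open>h j = \<lceil>j p / q\<rceil>\<close>.  The
  \<open>i\<close>-th letter of \<open>u\<^sub>r\<close> has sign \<open>(-1)\<close> to the power \<open>\<lfloor>i q / p\<rfloor>\<close>, for all \<open>i < 2 p\<close> and hence, by
  periodicity, around the whole cyclic word.  Therefore the sign blocks start at the numbers
  \<open>h j\<close>, and \<open>CS(r)\<close> is the periodic sequence \<open>h (j + 1) - h j\<close> read for \<open>2 q\<close> terms
  (\<open>CS_eq_block_lengths\<close>).

  Let \<open>a/b < r < c/d\<close> be the Farey parents of \<open>r\<close>, so that \<open>q = a + c\<close>, \<open>p = b + d\<close> and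
  \<open>b c - a d = 1\<close>.  Almost all windows of \<open>a\<close> consecutive terms of \<open>CS(r)\<close> have sum \<open>b\<close>, and
  modulo \<open>q\<close> there is a single exception, with sum \<open>b - 1\<close>; likewise a single window of length
  \<open>c\<close> has sum \<open>d + 1\<close> instead of \<open>d\<close> (\<open>short_window\<close>, \<open>long_window\<close>).  A factor of \<open>CS(r)\<close> that
  contains neither exceptional window also occurs \<open>a\<close> or \<open>c\<close> places further on
  (\<open>unrepeated_contains_window\<close>).  So a factor that occurs just twice in \<open>CS(r)\<close>, that is, once
  modulo \<open>q\<close>, contains an exceptional window.  Since \<open>S\<^sub>1\<close> and \<open>S\<^sub>2\<close> together fill one period, one
  of them contains the exceptional window of length \<open>a\<close> and the other the one of length \<open>c\<close>
  (\<open>decomposition_windows\<close>).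

  In \<open>CS(s)\<close> every window of length \<open>n\<close> has a sum strictly between \<open>n/s - 1\<close> and \<open>n/s + 1\<close>
  (\<open>window_bounds\<close>).  If \<open>CS(s)\<close> contains both exceptional windows, this gives
  \<open>a < s b\<close> and \<open>s d < c\<close>: the slope \<open>s\<close> lies strictly between the Farey parents of \<open>r\<close>.  For
  \<open>k = 1\<close> the parents are \<open>0\<close> and \<open>1 / (m\<^sub>1 - 1)\<close>, and a single term of size at least \<open>m\<^sub>1\<close> plays
  the role of the long window.  Finally, the parents of \<open>[m\<^sub>1, \<dots>, m\<^sub>k]\<close> are
  \<open>[m\<^sub>1, \<dots>, m\<^bsub>k-1\<^esub>]\<close> and \<open>[m\<^sub>1, \<dots>, m\<^sub>k - 1]\<close>, and the three conclusions say precisely that the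
  expansion of \<open>s\<close> belongs to a number strictly between these two (\<open>between_farey_parents\<close>).\<close>

section \<open>Continued fractions and Farey parents\<close>

lemma cfrac_bounds:
  assumes "\<forall>x \<in> set m. 0 < x"
  shows "0 \<le> cfrac m" "m \<noteq> [] \<Longrightarrow> 0 < cfrac m" "cfrac m \<le> 1"
proof -
  have "0 \<le> cfrac m \<and> (m \<noteq> [] \<longrightarrow> 0 < cfrac m) \<and> cfrac m \<le> 1"
    using assms
  proof (induction m)
    case (Cons x m)
    then have "1 \<le> rat_of_nat x" by (simp add: Suc_leI)
    moreover have "0 \<le> cfrac m" using Cons by simp
    ultimately show ?case by (simp add: divide_le_eq)
  qed simp
  then show "0 \<le> cfrac m" "m \<noteq> [] \<Longrightarrow> 0 < cfrac m" "cfrac m \<le> 1" by auto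
qed

lemma cfrac_less_1:
  assumes "\<forall>x \<in> set m. 0 < x" "m \<noteq> [] \<Longrightarrow> 2 \<le> last m"
  shows "cfrac m < 1"
proof (cases m)
  case (Cons x xs)
  then have x: "1 \<le> rat_of_nat x" using assms(1) by (simp add: Suc_leI)
  have "1 < rat_of_nat x + cfrac xs"
  proof (cases "xs = []")
    case True
    then show ?thesis using assms(2) Cons by simp
  next
    case False
    then have "0 < cfrac xs" using cfrac_bounds(2)[of xs] assms(1) Cons by simp
    then show ?thesis using x by simp
  qed
  then show ?thesis using Cons by simp
qed simp

definition strictly_between :: "rat \<Rightarrow> rat \<Rightarrow> rat \<Rightarrow> bool" where
  "strictly_between x y s \<longleftrightarrow> x < s \<and> s < y \<or> y < s \<and> s < x"

text \<open>The mediant \<open>(a + c) / (b + d)\<close> of two fractions with determinant \<open>\<plusminus>1\<close> is mapped by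
  \<open>z \<mapsto> 1 / (x + z)\<close> to the mediant of their images, and the determinant changes its sign; this
  is why the order of the two parents alternates with the length of the expansion.\<close>

lemma cfrac_farey_parents:
  assumes "m \<noteq> []" "\<forall>x \<in> set m. 0 < x" "2 \<le> last m"
  shows "\<exists>a b c d :: nat. 0 < b \<and> 0 < c \<and> 0 < d \<and> (length m \<ge> 2 \<longrightarrow> 0 < a) \<and>
    cfrac (butlast m) = of_nat a / of_nat b \<and>
    cfrac (butlast m @ [last m - 1]) = of_nat c / of_nat d \<and>
    cfrac m = of_nat (a + c) / of_nat (b + d) \<and>
    (b * c = a * d + 1 \<or> a * d = b * c + 1)"
  using assms
proof (induction m)
  case (Cons x m)
  show ?case
  proof (cases "m = []")
    case True
    \<comment> \<open>the parents of \<open>1/x\<close> are \<open>0/1\<close> and \<open>1/(x - 1)\<close>\<close>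
    then show ?thesis using Cons.prems
      by (intro exI[of _ 0] exI[of _ 1] exI[of _ 1] exI[of _ "x - 1"]) (auto simp: of_nat_diff)
  next
    case False
    then obtain a b c d :: nat where h: "0 < b" "0 < c" "0 < d"
      "cfrac (butlast m) = of_nat a / of_nat b"
      "cfrac (butlast m @ [last m - 1]) = of_nat c / of_nat d"
      "cfrac m = of_nat (a + c) / of_nat (b + d)"
      "b * c = a * d + 1 \<or> a * d = b * c + 1"
      using Cons by auto
    have inv: "1 / (of_nat x + of_nat u / of_nat v) = (of_nat v / of_nat (x * v + u) :: rat)"
      if "0 < v" for u v :: nat using that by (simp add: field_simps)
    show ?thesis
    proof (intro exI conjI)
      show "cfrac (butlast (x # m)) = of_nat b / of_nat (x * b + a)"
        using False h(1,4) inv[of b a] by simp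
      show "cfrac (butlast (x # m) @ [last (x # m) - 1]) = of_nat d / of_nat (x * d + c)"
        using False h(3,5) inv[of d c] by simp
      show "cfrac (x # m) = of_nat (b + d) / of_nat ((x * b + a) + (x * d + c))"
        using h(1,6) inv[of "b + d" "a + c"] by (simp add: algebra_simps)
      show "(x * b + a) * d = b * (x * d + c) + 1 \<or> b * (x * d + c) = (x * b + a) * d + 1"
        using h(7) by (auto simp: algebra_simps)
    qed (use h Cons.prems in auto)
  qed
qed simp

text \<open>If \<open>1/s\<close> lies strictly between \<open>x + x'\<close> and \<open>x + y'\<close> with \<open>x'\<close> and \<open>y'\<close> in \<open>[0, 1]\<close>, then its
  integer part is \<open>x\<close>, so that the first partial quotients agree and the remaining expansions
  satisfy the same hypothesis.  At the last partial quotient \<open>x\<close> of \<open>m\<close>, the hypothesis says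
  that \<open>1/s > x - 1\<close>.\<close>

lemma between_farey_parents:
  assumes "m \<noteq> []" "\<forall>x \<in> set m. 0 < x" "2 \<le> last m"
    and "l \<noteq> []" "\<forall>x \<in> set l. 0 < x" "length l \<noteq> 1 \<longrightarrow> 2 \<le> last l"
    and "strictly_between (cfrac (butlast m)) (cfrac (butlast m @ [last m - 1])) (cfrac l)"
  shows "length m \<le> length l \<and> (\<forall>i < length m - 1. l ! i = m ! i) \<and>
    (m ! (length m - 1) \<le> l ! (length m - 1) \<or>
     l ! (length m - 1) = m ! (length m - 1) - 1 \<and> length m < length l)"
  using assms
proof (induction m arbitrary: l)
  case (Cons x m)
  obtain y l' where l: "l = y # l'" using Cons.prems(4) by (cases l) auto
  define s' where "s' = cfrac l'"
  have y: "1 \<le> rat_of_nat y" using Cons.prems(5) l by (simp add: Suc_leI)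
  have s': "0 \<le> s'" "s' < 1" and s'_pos: "0 < s' \<longleftrightarrow> l' \<noteq> []"
    using Cons.prems(5,6) l cfrac_bounds[of l'] cfrac_less_1[of l']
    by (auto simp: s'_def split: if_splits)
  have s: "cfrac l = 1 / (of_nat y + s')" by (simp add: l s'_def)
  show ?case
  proof (cases "m = []")
    case True
    then have x: "2 \<le> x" using Cons.prems by simp
    have "cfrac l < 1 / of_nat (x - 1)" "0 \<le> cfrac l"
      using Cons.prems(7) True s y s' by (auto simp: strictly_between_def not_less[symmetric] of_nat_diff)
    then have "of_nat (x - 1) < of_nat y + s'" using s y s' x by (simp add: field_simps)
    then have *: "of_nat x < of_nat y + s' + 1" using x by (simp add: of_nat_diff)
    then have "rat_of_nat x < rat_of_nat (y + 2)" using s' by simp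
    then have "x < y + 2" by (simp only: of_nat_less_iff)
    moreover have "x < y + 1" if "l' = []"
    proof -
      have "rat_of_nat x < rat_of_nat (y + 1)" using * s' s'_pos that by simp
      then show ?thesis by (simp only: of_nat_less_iff)
    qed
    ultimately show ?thesis using True l by (cases l') auto
  next
    case False
    define x' where "x' = cfrac (butlast m)"
    define y' where "y' = cfrac (butlast m @ [last m - 1])"
    have x: "1 \<le> rat_of_nat x" using Cons.prems(2) by (simp add: Suc_leI)
    have pos: "\<forall>i \<in> set (butlast m). 0 < i" using Cons.prems(2) by (auto dest: in_set_butlastD)
    have "2 \<le> last m" using Cons.prems(3) False by simp
    then have x'y': "0 \<le> x'" "x' \<le> 1" "0 \<le> y'" "y' \<le> 1"
      using pos cfrac_bounds[of "butlast m"] cfrac_bounds[of "butlast m @ [last m - 1]"]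
      by (auto simp: x'_def y'_def)
    have "strictly_between (1 / (of_nat x + x')) (1 / (of_nat x + y')) (1 / (of_nat y + s'))"
      using Cons.prems(7) False s by (simp add: x'_def y'_def)
    moreover have "1 / u < 1 / v \<longleftrightarrow> v < u" if "1 \<le> u" "1 \<le> v" for u v :: rat
      using that by (auto simp: field_simps)
    ultimately have between: "strictly_between (of_nat x + x') (of_nat x + y') (of_nat y + s')"
      using x y x'y' s' by (auto simp: strictly_between_def)
    then have "rat_of_nat x < rat_of_nat (y + 1)" "rat_of_nat y < rat_of_nat (x + 1)"
      using x'y' s' by (auto simp: strictly_between_def)
    then have "y = x" by (simp only: of_nat_less_iff)
    then have b': "strictly_between x' y' s'" using between by (simp add: strictly_between_def)
    then have "0 < s'" using x'y' by (auto simp: strictly_between_def)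
    then have "l' \<noteq> []" using s'_pos by simp
    then have "length m \<le> length l' \<and> (\<forall>i < length m - 1. l' ! i = m ! i) \<and>
      (m ! (length m - 1) \<le> l' ! (length m - 1) \<or>
       l' ! (length m - 1) = m ! (length m - 1) - 1 \<and> length m < length l')"
      using Cons.prems False l b'
      by (intro Cons.IH) (auto simp: s'_def x'_def y'_def)
    moreover have "(\<forall>i < length (x # m) - 1. l ! i = (x # m) ! i)"
      if "\<forall>i < length m - 1. l' ! i = m ! i"
      using that \<open>y = x\<close> l by (auto simp: nth_Cons split: nat.splits)
    ultimately show ?thesis using False l by (auto simp: nth_Cons')
  qed
qed simp

lemma farey_coprime:
  fixes a b c d :: nat
  assumes "b * c = a * d + 1"
  shows "coprime (a + c) (b + d)"
proof (rule coprimeI)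
  fix x assume "x dvd a + c" "x dvd b + d"
  then have "x dvd b * (a + c) - a * (b + d)" by (intro dvd_diff_nat) simp_all
  also have "b * (a + c) - a * (b + d) = 1"
    using assms by (simp add: distrib_left mult.commute[of b a])
  finally show "is_unit x" .
qed

section \<open>Block starts and block lengths\<close>

text \<open>This is the ceiling of \<open>j p / q\<close>, the least \<open>i\<close> with \<open>\<lfloor>i q / p\<rfloor> \<ge> j\<close>.  The sign
  \<open>(-1)\<close> to the power \<open>\<lfloor>i q / p\<rfloor>\<close> changes exactly at these positions if \<open>q \<le> p\<close>.\<close>

definition block_start :: "nat \<Rightarrow> nat \<Rightarrow> nat \<Rightarrow> nat" where
  "block_start p q j = (j * p + (q - 1)) div q"

lemma block_start_le_iff:
  assumes "q > 0"
  shows "block_start p q j \<le> i \<longleftrightarrow> j * p \<le> i * q"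
proof -
  have "block_start p q j \<le> i \<longleftrightarrow> (j * p + (q - 1)) div q < Suc i"
    by (auto simp: block_start_def)
  also have "\<dots> \<longleftrightarrow> j * p + (q - 1) < Suc i * q"
    using assms by (simp add: div_less_iff_less_mult del: mult_Suc)
  also have "\<dots> \<longleftrightarrow> j * p \<le> i * q" using assms by auto
  finally show ?thesis .
qed

lemma block_start_bounds:
  assumes "q > 0"
  shows "j * p \<le> block_start p q j * q" "block_start p q j * q < j * p + q"
proof -
  show "j * p \<le> block_start p q j * q" using block_start_le_iff[OF assms, of p j] by blast
  show "block_start p q j * q < j * p + q"
  proof (cases "block_start p q j")
    case (Suc i)
    then have "i * q < j * p" using block_start_le_iff[OF assms, of p j i] by simp
    then show ?thesis using Suc by simp
  qed (use assms in simp)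
qed

lemma block_start_period:
  "q > 0 \<Longrightarrow> block_start p q (j + n * q) = block_start p q j + n * p"
proof -
  assume "q > 0"
  moreover have "(j + n * q) * p + (q - 1) = (j * p + (q - 1)) + (n * p) * q"
    by (simp add: algebra_simps)
  ultimately show ?thesis unfolding block_start_def by (metis add.commute div_mult_self1 less_not_refl)
qed

lemma block_start_mono: "i \<le> j \<Longrightarrow> block_start p q i \<le> block_start p q j"
  unfolding block_start_def by (intro div_le_mono add_mono mult_le_mono) auto

lemma block_start_strict_mono:
  assumes "0 < q" "q \<le> p" "i < j"
  shows "block_start p q i < block_start p q j"
proof -
  have "block_start p q i * q < i * p + q" by (rule block_start_bounds[OF assms(1)])
  also have "\<dots> \<le> Suc i * p" using assms(2) by simp
  also have "\<dots> \<le> j * p" using assms(3) by (intro mult_le_mono) auto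
  also have "\<dots> \<le> block_start p q j * q" by (rule block_start_bounds[OF assms(1)])
  finally show ?thesis by simp
qed

lemma eq_block_start:
  assumes "0 < q" "0 < p" "0 < i" "(i - 1) * q div p < i * q div p"
  shows "i = block_start p q (i * q div p)"
proof (rule antisym)
  have "\<not> (i * q div p) * p \<le> (i - 1) * q"
    using assms(2,4) by (simp add: less_eq_div_iff_mult_less_eq[symmetric])
  then have "\<not> block_start p q (i * q div p) \<le> i - 1"
    using block_start_le_iff[OF assms(1)] by blast
  then show "i \<le> block_start p q (i * q div p)" by simp
  show "block_start p q (i * q div p) \<le> i"
    using block_start_le_iff[OF assms(1)] by simp
qed

text \<open>The lengths of \<open>n\<close> consecutive sign blocks, beginning with block \<open>J\<close>; for varying \<open>J\<close> these
  are the factors of length \<open>n\<close> of the periodic sequence behind \<open>CS(q/p)\<close>.\<close>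

definition block_lengths :: "nat \<Rightarrow> nat \<Rightarrow> nat \<Rightarrow> nat \<Rightarrow> nat list" where
  "block_lengths p q J n = map (\<lambda>j. block_start p q (Suc j) - block_start p q j) [J..<J + n]"

lemma length_block_lengths [simp]: "length (block_lengths p q J n) = n"
  by (simp add: block_lengths_def)

lemma nth_block_lengths:
  "i < n \<Longrightarrow> block_lengths p q J n ! i = block_start p q (Suc (J + i)) - block_start p q (J + i)"
  by (simp add: block_lengths_def)

lemma block_lengths_append:
  "block_lengths p q J (m + n) = block_lengths p q J m @ block_lengths p q (J + m) n"
  by (simp add: block_lengths_def upt_add_eq_append[of J "J + m" n, simplified] flip: add.assoc)

lemma sum_list_block_lengths:
  "sum_list (block_lengths p q J n) = block_start p q (J + n) - block_start p q J"
proof (induction n)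
  case (Suc n)
  have "block_start p q J \<le> block_start p q (J + n)"
    "block_start p q (J + n) \<le> block_start p q (Suc (J + n))" by (intro block_start_mono; simp)+
  with Suc show ?case by (simp add: block_lengths_def)
qed (simp add: block_lengths_def)

lemma sublist_block_lengths:
  assumes "sublist ys (block_lengths p q J n)"
  obtains K where "ys = block_lengths p q K (length ys)"
proof -
  obtain us vs where e: "block_lengths p q J n = us @ ys @ vs" using assms by (auto simp: sublist_def)
  then have "n = length us + (length ys + length vs)" using length_block_lengths by (metis length_append)
  then have "us @ ys @ vs = block_lengths p q J (length us) @
     block_lengths p q (J + length us) (length ys) @ block_lengths p q (J + length us + length ys) (length vs)"
    using e by (simp add: block_lengths_append)
  then have "ys = block_lengths p q (J + length us) (length ys)" by simp
  then show ?thesis by (rule that)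
qed

lemma sublist_block_lengthsI:
  assumes "J \<le> K" "K + m \<le> J + n"
  shows "sublist (block_lengths p q K m) (block_lengths p q J n)"
proof -
  have "block_lengths p q J n = block_lengths p q J ((K - J) + (m + (J + n - (K + m))))"
    using assms by simp
  also have "\<dots> = block_lengths p q J (K - J) @ block_lengths p q K m @
      block_lengths p q (K + m) (J + n - (K + m))"
    using assms unfolding block_lengths_append by simp
  finally show ?thesis by auto
qed

section \<open>The cyclic S-sequence of a rational number\<close>

lemma rat_num_den:
  assumes "0 < r" "r \<le> 1"
  shows "0 < rat_num r" "rat_num r \<le> rat_den r" "coprime (rat_num r) (rat_den r)"
    "r = of_nat (rat_num r) / of_nat (rat_den r)"
proof -
  obtain n d where nd: "quotient_of r = (n, d)" by force
  have d: "d > 0" and c: "coprime n d" and e: "r = of_int n / of_int d"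
    using quotient_of_denom_pos[OF nd] quotient_of_coprime[OF nd] quotient_of_div[OF nd] by auto
  have n: "n > 0" using assms(1) d e by (simp add: zero_less_divide_iff)
  have le: "n \<le> d" using assms(2) d e by (simp add: divide_le_eq)
  have q: "int (rat_num r) = n" and p: "int (rat_den r) = d"
    using nd n d by (auto simp: rat_num_def rat_den_def)
  show "0 < rat_num r" "rat_num r \<le> rat_den r" using n le q p by linarith+
  show "coprime (rat_num r) (rat_den r)" using c unfolding q[symmetric] p[symmetric] by simp
  show "r = of_nat (rat_num r) / of_nat (rat_den r)"
    using e by (metis q p of_int_of_nat_eq)
qed

lemma rat_num_den_unique:
  assumes "r = of_nat q / of_nat p" "coprime q p" "p > 0"
  shows "rat_num r = q" "rat_den r = p"
proof -
  have "quotient_of r = (int q, int p)"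
  proof -
    have "r = Fract (int q) (int p)" using assms by (simp add: Fract_of_int_quotient)
    moreover have "Rat.normalize (int q, int p) = (int q, int p)"
      using assms by (simp add: Rat.normalize_def Let_def)
    ultimately show ?thesis by (simp add: quotient_of_Fract)
  qed
  then show "rat_num r = q" "rat_den r = p" by (auto simp: rat_num_def rat_den_def)
qed

lemma length_u_word: "0 < rat_den r \<Longrightarrow> length (u_word r) = 2 * rat_den r"
  by (simp add: u_word_def u_hat_def word_inv_def)

text \<open>The numbers \<open>k q / p\<close> and \<open>(2 p - k) q / p\<close> add up to the integer \<open>2 q\<close>; as they are not
  integers, their fractional parts add up to \<open>1\<close>.  Hence the two floors have opposite parity,
  which matches the inversion of \<open>u_hat\<close> in the second half of \<open>u_word\<close>.\<close>

lemma floor_reflect: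
  fixes p q k :: nat
  assumes "0 < p" "\<not> p dvd k * q" "k \<le> 2 * p"
  shows "(2 * p - k) * q div p + k * q div p + 1 = 2 * q"
proof -
  define A where "A = k * q div p"
  define R where "R = k * q mod p"
  have kq: "k * q = A * p + R" by (simp add: A_def R_def)
  have R: "0 < R" "R < p" using assms by (auto simp: R_def mod_greater_zero_iff_not_dvd)
  have le: "k * q \<le> 2 * p * q" using assms(3) by simp
  have "2 * p * q = 2 * q * p" by simp
  then have "A * p < 2 * q * p" using kq R le by linarith
  then have A: "A < 2 * q" by (rule mult_right_less_imp_less) simp
  then obtain B where B: "2 * q = Suc (A + B)" using less_iff_Suc_add by auto
  have "(2 * p - k) * q = 2 * q * p - k * q" by (simp add: diff_mult_distrib diff_mult_distrib2 mult.commute mult.left_commute)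
  also have "\<dots> = B * p + (p - R)" using R unfolding B kq by (simp add: algebra_simps)
  finally have "(2 * p - k) * q div p = B + (p - R) div p" using assms(1) by simp
  also have "(p - R) div p = 0" using R by simp
  finally show ?thesis using B by (simp add: A_def)
qed

text \<open>The signs in the half \<open>word_inv (u_hat r)\<close> continue the formula that holds by definition in
  the half \<open>u_hat r\<close>.  The letter between the halves fits as well: for even denominators
  the numerator is odd, so there, too, its exponent \<open>-1\<close> is \<open>(-1)\<close> to the power \<open>rat_num r\<close>.\<close>

lemma sign_u_word:
  assumes "0 < r" "r \<le> 1" "i < 2 * rat_den r"
  shows "snd (u_word r ! i) = (-1) ^ (i * rat_num r div rat_den r)"
proof -
  note rr = rat_num_den[OF assms(1,2)]
  define p where "p = rat_den r"
  define q where "q = rat_num r"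
  have p: "0 < p" using rr by (simp add: p_def)
  have cop: "coprime q p" using rr by (simp add: p_def q_def)
  have "(-1::int) ^ q = -1" if "even p" using cop that
    by (metis coprime_common_divisor odd_one uminus_power_if power_one)
  then have "u_word r = (Gen_a, 1) # u_hat r @
      (if odd p then Gen_b else Gen_a, (-1) ^ q) # word_inv (u_hat r)"
    by (simp add: u_word_def p_def q_def)
  then obtain g where u: "u_word r = (Gen_a, 1) # u_hat r @ (g, (-1) ^ q) # word_inv (u_hat r)" ..
  have len: "length (u_hat r) = p - 1" by (simp add: u_hat_def p_def)
  have hat: "snd (u_hat r ! j) = (-1) ^ (Suc j * q div p)" if "j < p - 1" for j
    using that by (simp add: u_hat_def eps_def p_def q_def)
  consider "i = 0" | "0 < i" "i < p" | "i = p" | "p < i" by linarith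
  then have "snd (u_word r ! i) = (-1) ^ (i * q div p)"
  proof cases
    case 1
    then show ?thesis by (simp add: u)
  next
    case 2
    then show ?thesis using hat[of "i - 1"] by (simp add: u nth_append len)
  next
    case 3
    then show ?thesis using p by (simp add: u nth_append len nth_Cons')
  next
    case 4
    define k where "k = 2 * p - i"
    have i: "i < 2 * p" using assms by (simp add: p_def)
    have k: "0 < k" "k < p" "i = 2 * p - k" using 4 i by (auto simp: k_def)
    have "u_word r ! i = word_inv (u_hat r) ! (i - p - 1)"
      using 4 p by (auto simp: u nth_append len nth_Cons')
    also have "snd \<dots> = - snd (u_hat r ! (k - 1))"
    proof -
      have "i - p - 1 < p - 1" "p - 1 - Suc (i - p - 1) = k - 1" using 4 i by (auto simp: k_def)
      then show ?thesis by (simp add: word_inv_def rev_nth len case_prod_beta)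
    qed
    also have "snd (u_hat r ! (k - 1)) = (-1) ^ (k * q div p)" using k hat[of "k - 1"] by simp
    finally have e: "snd (u_word r ! i) = - ((-1) ^ (k * q div p))" .
    have "\<not> p dvd k * q" using k cop
      by (metis coprime_commute coprime_dvd_mult_left_iff dvd_imp_le leD)
    then have "i * q div p + k * q div p + 1 = 2 * q" using floor_reflect[of p k q] k by simp
    then have "even (i * q div p) \<longleftrightarrow> odd (k * q div p)" by (metis even_add even_mult_iff even_numeral odd_one)
    then show ?thesis using e by (simp add: uminus_power_if)
  qed
  then show ?thesis by (simp add: p_def q_def)
qed

lemma nth_concat_block:
  assumes "j < length vs" "i < length (vs ! j)"
  shows "concat vs ! (sum_list (map length (take j vs)) + i) = vs ! j ! i"
    and "sum_list (map length (take j vs)) + i < length (concat vs)"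
proof -
  have "concat vs = concat (take j vs) @ vs ! j @ concat (drop (Suc j) vs)"
    using assms(1) by (metis concat.simps(2) concat_append id_take_nth_drop)
  moreover have "length (concat (take j vs)) = sum_list (map length (take j vs))"
    by (simp add: length_concat)
  ultimately show "concat vs ! (sum_list (map length (take j vs)) + i) = vs ! j ! i"
    "sum_list (map length (take j vs)) + i < length (concat vs)"
    using assms by (simp_all add: nth_append)
qed

text \<open>For signs \<open>(-1)\<close> to the power \<open>F i\<close> with \<open>F\<close> growing in steps of \<open>0\<close> or \<open>1\<close>, a change of sign is
  the same as a step of \<open>F\<close>.  So \<open>F\<close> counts the blocks, and \<open>P j\<close>, the start of block \<open>j\<close>, is a
  position at which \<open>F\<close> increases.  For \<open>j = 0\<close> this expresses the change of sign from the last
  block to the first.\<close>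

lemma sign_blocks_steps:
  fixes F :: "nat \<Rightarrow> nat"
  assumes vs: "sign_blocks vs" "vs \<noteq> []"
    and sign: "\<And>i. i < length (concat vs) \<Longrightarrow> snd (concat vs ! i) = (-1) ^ F (N + i)"
    and step: "\<And>i. F (Suc i) = F i \<or> F (Suc i) = Suc (F i)"
    and period: "\<And>i. even (F (i + length (concat vs))) \<longleftrightarrow> even (F i)"
    and N: "N > 0"
    and j: "j \<le> length vs"
  defines "P \<equiv> \<lambda>j. sum_list (map length (take j vs))"
  shows "F (N + P j) = F N + j \<and> F (N + P j - 1) < F (N + P j)"
proof -
  let ?n = "length (concat vs)" and ?L = "length vs"
  have PS: "P (Suc j) = P j + length (vs ! j)" if "j < ?L" for j
    using that by (simp add: P_def take_Suc_conv_app_nth)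
  have PL: "P ?L = ?n" by (simp add: P_def length_concat)
  have ne: "0 < length (vs ! j)" if "j < ?L" for j
    using vs(1) that by (simp add: sign_blocks_def)
  have letter: "snd (vs ! j ! i) = (-1) ^ F (N + (P j + i))" if "j < ?L" "i < length (vs ! j)" for i j
    using nth_concat_block[OF that] sign[of "P j + i"] by (simp add: P_def)
  have inside: "even (F (N + (P j + i))) \<longleftrightarrow> even (F (N + P j))"
    if "j < ?L" "i < length (vs ! j)" for i j
  proof -
    have "snd (vs ! j ! i) = snd (vs ! j ! 0)"
      using vs(1) that ne[of j] unfolding sign_blocks_def by (meson nth_mem)
    then show ?thesis using letter[of j i] letter[of j 0] that ne[of j] 
      by (auto simp: uminus_power_if split: if_splits)
  qed
  have const: "F (N + (P j + i)) = F (N + P j)" if "j < ?L" "i < length (vs ! j)" for i j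
    using that
  proof (induction i)
    case (Suc i)
    then have IH: "F (N + (P j + i)) = F (N + P j)" by simp
    moreover have "even (F (N + (P j + Suc i))) \<longleftrightarrow> even (F (N + P j))" using inside Suc.prems by blast
    ultimately show ?case using step[of "N + (P j + i)"] by auto
  qed simp
  \<comment> \<open>for the last block, position \<open>P (Suc j)\<close> is one period after position \<open>0\<close>\<close>
  have start: "even (F (N + P (Suc j))) \<longleftrightarrow> even (F (N + P (Suc j mod ?L)))" if "j < ?L" for j
  proof (cases "Suc j = ?L")
    case True
    then show ?thesis using period[of N] by (simp add: PL) (simp add: P_def)
  next
    case False
    then show ?thesis using that by simp
  qed
  have jump: "even (F (N + P (Suc j))) \<noteq> even (F (N + P (Suc j) - 1))" if j: "j < ?L" for j
  proof -
    let ?j = "Suc j mod ?L"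
    have j': "?j < ?L" using vs(2) by simp
    let ?i = "length (vs ! j) - 1"
    have i: "?i < length (vs ! j)" using ne[OF j] by simp
    have "snd (vs ! ?j ! 0) = - snd (vs ! j ! ?i)"
      using vs(1) j ne[OF j'] i by (auto simp: sign_blocks_def)
    then have "even (F (N + P ?j)) \<noteq> even (F (N + (P j + ?i)))"
      using letter[OF j', of 0] letter[OF j i] ne[OF j']
      by (auto simp: uminus_power_if split: if_splits)
    moreover have "N + (P j + ?i) = N + P (Suc j) - 1" unfolding PS[OF j] using ne[OF j] by arith
    ultimately show ?thesis using start[OF j] by simp
  qed
  have less: "F (i - 1) < F i" if "even (F i) \<noteq> even (F (i - 1))" "i > 0" for i
    using step[of "i - 1"] that by auto
  show ?thesis using j
  proof (induction j)
    case 0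
    have "?L - 1 < ?L" "Suc (?L - 1) = ?L" using vs(2) by auto
    then have "even (F (N + ?n)) \<noteq> even (F (N + ?n - 1))" using jump[of "?L - 1"] PL by simp
    moreover have "N + ?n - 1 = (N - 1) + ?n" using N by simp
    ultimately have "even (F N) \<noteq> even (F (N - 1))" using period by simp
    then show ?case using less N by (simp add: P_def)
  next
    case (Suc j)
    then have j: "j < ?L" by simp
    have l: "F (N + P (Suc j) - 1) < F (N + P (Suc j))" using less jump[OF j] N by simp
    have "N + (P j + (length (vs ! j) - 1)) = N + P (Suc j) - 1" unfolding PS[OF j] using ne[OF j] by arith
    then have "F (N + P (Suc j) - 1) = F (N + P j)"
      using const[OF j, of "length (vs ! j) - 1"] ne[OF j] by simp
    then have "F (N + P (Suc j)) = Suc (F (N + P j))"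
      using l step[of "N + P (Suc j) - 1"] N by auto
    then show ?case using Suc l by simp
  qed
qed

text \<open>Every representative of \<open>CS r\<close> is a full double period of block lengths, starting at some
  block.  By \<open>sign_blocks_steps\<close> the blocks start where \<open>\<lfloor>i q / p\<rfloor>\<close> increases, and these are the
  values of \<open>block_start\<close>.\<close>

lemma CS_eq_block_lengths:
  assumes r: "0 < r" "r \<le> 1" and xs: "xs \<in> CS r"
  obtains J where "xs = block_lengths (rat_den r) (rat_num r) J (2 * rat_num r)"
proof -
  define p where "p = rat_den r"
  define q where "q = rat_num r"
  have q: "0 < q" "q \<le> p" using rat_num_den[OF r] by (auto simp: p_def q_def)
  then have p: "0 < p" by simp
  obtain vs n where vs: "xs = map length vs" "sign_blocks vs" "concat vs = rotate n (u_word r)"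
    using xs by (auto simp: CS_def CS_word_def cyclic_def)
  have len: "length (concat vs) = 2 * p" using length_u_word[of r] p vs(3) by (simp add: p_def)
  then have vs_ne: "vs \<noteq> []" using p by auto
  define F where "F = (\<lambda>i. i * q div p)"
  \<comment> \<open>a rotation by one more period, so that the position \<open>N - 1\<close> before the first letter exists\<close>
  define N where "N = n + 2 * p"
  have shift: "F (i + 2 * p) = F i + 2 * q" for i
  proof -
    have "(i + 2 * p) * q = i * q + (2 * q) * p" by (simp add: algebra_simps)
    then show ?thesis using p by (simp add: F_def)
  qed
  have shift_mod: "even (F (i mod (2 * p))) \<longleftrightarrow> even (F i)" for i
  proof -
    have "even (F (i + k * (2 * p))) \<longleftrightarrow> even (F i)" for i k
    proof (induction k)
      case (Suc k)
      have "i + Suc k * (2 * p) = (i + k * (2 * p)) + 2 * p" by simp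
      then have "even (F (i + Suc k * (2 * p))) \<longleftrightarrow> even (F (i + k * (2 * p)))"
        by (simp only: shift) simp
      then show ?case using Suc by blast
    qed simp
    from this[of "i mod (2 * p)" "i div (2 * p)"] show ?thesis by (simp only: mod_div_mult_eq)
  qed
  have sign: "snd (concat vs ! i) = (-1) ^ F (N + i)" if "i < length (concat vs)" for i
  proof -
    have i: "i < length (u_word r)" using that vs(3) by simp
    then have l2: "length (u_word r) = 2 * p" using len vs(3) by simp
    have "concat vs ! i = u_word r ! ((n + i) mod (2 * p))" using i by (simp add: vs(3) nth_rotate l2)
    also have "snd \<dots> = (-1) ^ F ((n + i) mod (2 * p))"
      using sign_u_word[OF r, of "(n + i) mod (2 * p)"] p by (simp add: F_def p_def q_def)
    also have "(n + i) mod (2 * p) = (N + i) mod (2 * p)"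
      by (metis N_def add.assoc add.commute mod_add_self2)
    also have "(-1::int) ^ F ((N + i) mod (2 * p)) = (-1) ^ F (N + i)"
      using shift_mod[of "N + i"] by (simp add: uminus_power_if)
    finally show ?thesis .
  qed
  have step: "F (Suc i) = F i \<or> F (Suc i) = Suc (F i)" for i
  proof -
    have "F i \<le> F (Suc i)" unfolding F_def by (intro div_le_mono) simp
    moreover have "F (Suc i) \<le> (i * q + p) div p"
      unfolding F_def using q(2) by (intro div_le_mono) simp
    then have "F (Suc i) \<le> Suc (F i)" using p by (simp add: F_def)
    ultimately show ?thesis by linarith
  qed
  have "N > 0" using p by (simp add: N_def)
  define P where "P = (\<lambda>j. sum_list (map length (take j vs)))"
  define J where "J = F N"
  let ?h = "block_start p q"
  have P: "N + P j = ?h (J + j)" if "j \<le> length vs" for j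
  proof -
    have *: "F (N + P j) = J + j" "F (N + P j - 1) < F (N + P j)"
      using sign_blocks_steps[OF vs(2) vs_ne sign step _ \<open>N > 0\<close> that] shift
      by (auto simp: P_def J_def len)
    show ?thesis using eq_block_start[of q p "N + P j"] * q p \<open>N > 0\<close> by (simp add: F_def)
  qed
  have "?h (J + length vs) = ?h J + 2 * p"
    using P[of "length vs"] P[of 0] len by (simp add: P_def length_concat)
  also have "\<dots> = ?h (J + 2 * q)" using block_start_period[of q p J 2] q by simp
  finally have L: "length vs = 2 * q"
    using block_start_strict_mono[OF q] by (metis add_left_cancel less_irrefl linorder_neqE_nat)
  have "xs = block_lengths p q J (2 * q)"
  proof (rule nth_equalityI)
    fix i assume "i < length xs"
    then have i: "i < length vs" by (simp add: vs(1))
    have "xs ! i = (N + P (Suc i)) - (N + P i)" using i by (simp add: vs(1) P_def take_Suc_conv_app_nth)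
    then show "xs ! i = block_lengths p q J (2 * q) ! i"
      using P[of i] P[of "Suc i"] i L by (simp add: nth_block_lengths)
  qed (simp add: vs(1) L)
  then show ?thesis using that by (simp add: p_def q_def)
qed

section \<open>The exceptional windows\<close>

text \<open>The defect \<open>q h(j) - j p\<close> lies in \<open>[0, q)\<close> and is congruent to \<open>- j p\<close> modulo \<open>q\<close>.  As
  \<open>a p = b q - 1\<close>, going from \<open>j\<close> to \<open>j + a\<close> increases it by \<open>1\<close> cyclically.  The window sum is
  \<open>b\<close> if there is no wrap-around and \<open>b - 1\<close> otherwise, and the wrap-around means that the
  new defect is \<open>0\<close>, that is, \<open>q\<close> divides \<open>j + a\<close>.\<close>

lemma short_window:
  fixes a b c d p q j :: nat
  assumes pq: "q = a + c" "p = b + d" and det: "b * c = a * d + 1" and c: "0 < c"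
  shows "block_start p q (j + a) + (if q dvd j + a then 1 else 0) = block_start p q j + b"
proof -
  have q: "0 < q" using pq c by simp
  let ?h = "\<lambda>j. int (block_start p q j)"
  \<comment> \<open>the defects before and after the window, and the deviation of its sum from \<open>b\<close>\<close>
  define X where "X = ?h j * q - int j * p"
  define Y where "Y = ?h (j + a) * q - int (j + a) * p"
  define E where "E = ?h (j + a) - ?h j - int b"
  have bounds: "0 \<le> ?h i * q - int i * p" "?h i * q - int i * p < q" for i
    using block_start_bounds[OF q, where p=p and j=i]
    by (simp_all flip: of_nat_mult of_nat_add add: algebra_simps)
  then have XY: "0 \<le> X" "X < q" "0 \<le> Y" "Y < q" unfolding X_def Y_def by blast+
  have "int a * p = int b * q - 1"
  proof -
    have "int b * c = int a * d + 1" using det by (metis of_nat_1 of_nat_add of_nat_mult)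
    then show ?thesis by (simp add: pq algebra_simps)
  qed
  then have E: "E * q = Y - X - 1" by (simp add: X_def Y_def E_def algebra_simps)
  have "E * q < 1 * int q" "(-2) * int q < E * q" using E XY q by linarith+
  then have "E < 1" "-2 < E" using q by (simp_all only: mult_less_cancel_right)
  then consider "E = 0" | "E = -1" by linarith
  moreover have "Y = 0 \<longleftrightarrow> q dvd j + a"
  proof -
    have cop: "coprime q p" using farey_coprime[OF det] by (simp add: pq)
    have "Y = 0 \<longleftrightarrow> int q dvd Y"
      using XY zdvd_imp_le[of "int q" Y] by (cases "Y = 0") auto
    also have "\<dots> \<longleftrightarrow> int q dvd int ((j + a) * p)" 
      unfolding Y_def by (subst dvd_diff_right_iff) auto
    also have "\<dots> \<longleftrightarrow> q dvd j + a"
      using cop by (simp only: int_dvd_int_iff coprime_dvd_mult_left_iff)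
    finally show ?thesis .
  qed
  ultimately show ?thesis
  proof cases
    case 1
    moreover have "Y \<noteq> 0" using 1 E XY by auto
    ultimately show ?thesis using \<open>Y = 0 \<longleftrightarrow> _\<close> by (simp add: E_def)
  next
    case 2
    moreover have "Y = 0" using 2 E XY by auto
    ultimately show ?thesis using \<open>Y = 0 \<longleftrightarrow> _\<close> by (simp add: E_def)
  qed
qed

text \<open>A window of length \<open>c\<close> together with the following window of length \<open>a\<close> is a full period,
  with sum \<open>b + d\<close>.\<close>

lemma long_window:
  fixes a b c d p q j :: nat
  assumes pq: "q = a + c" "p = b + d" and det: "b * c = a * d + 1" and c: "0 < c"
  shows "block_start p q (j + c) = block_start p q j + d + (if q dvd j then 1 else 0)"
proof -
  have e: "j + c + a = j + q" by (simp add: pq)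
  have "block_start p q (j + q) = block_start p q j + (b + d)"
    using block_start_period[of q p j 1] pq c by simp
  then show ?thesis using short_window[OF pq det c, of "j + c"]
    unfolding e by (auto split: if_splits)
qed

text \<open>Shifting by \<open>a\<close> changes a term at \<open>i\<close> only if the sums of the windows of length \<open>a\<close> at \<open>i\<close> and
  \<open>i + 1\<close> differ, so that one of these windows is exceptional; likewise for \<open>c\<close>.  Thus, if a
  factor changes under both shifts, an exceptional window of length \<open>a\<close> starts at some \<open>y\<close> and
  one of length \<open>c\<close> at some \<open>z\<close>, both within the factor or at its end.  The two kinds alternate:
  each starts where the previous one ends.  So the first of the two windows has ended when the
  second one starts, and it lies inside the factor.\<close>

lemma unrepeated_contains_window:
  fixes a b c d p q J n :: nat
  assumes pq: "q = a + c" "p = b + d" and det: "b * c = a * d + 1" and ac: "0 < a" "0 < c"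
    and shift_a: "block_lengths p q (J + a) n \<noteq> block_lengths p q J n"
    and shift_c: "block_lengths p q (J + c) n \<noteq> block_lengths p q J n"
  shows "(\<exists>y. J \<le> y \<and> y + a \<le> J + n \<and> q dvd y + a) \<or> (\<exists>z. J \<le> z \<and> z + c \<le> J + n \<and> q dvd z)"
proof -
  have "\<exists>y. J \<le> y \<and> y \<le> J + n \<and> q dvd y + a"
  proof (rule ccontr)
    assume no: "\<not> ?thesis"
    have "block_lengths p q (J + a) n = block_lengths p q J n"
    proof (rule nth_equalityI)
      fix i assume "i < length (block_lengths p q (J + a) n)"
      then have i: "i < n" by simp
      then have "\<not> q dvd (J + i) + a" "\<not> q dvd Suc (J + i) + a"
        using no by (metis add_Suc_right le_add1 nat_add_left_cancel_le Suc_leI less_imp_le_nat)+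
      then show "block_lengths p q (J + a) n ! i = block_lengths p q J n ! i"
        using i short_window[OF pq det ac(2), of "J + i"] short_window[OF pq det ac(2), of "Suc (J + i)"]
        by (simp add: nth_block_lengths ac_simps)
    qed simp
    with shift_a show False ..
  qed
  then obtain y where y: "J \<le> y" "y \<le> J + n" "q dvd y + a" by blast
  have "\<exists>z. J \<le> z \<and> z \<le> J + n \<and> q dvd z"
  proof (rule ccontr)
    assume no: "\<not> ?thesis"
    have "block_lengths p q (J + c) n = block_lengths p q J n"
    proof (rule nth_equalityI)
      fix i assume "i < length (block_lengths p q (J + c) n)"
      then have i: "i < n" by simp
      then have "\<not> q dvd (J + i)" "\<not> q dvd Suc (J + i)"
        using no by (metis add_Suc_right le_add1 nat_add_left_cancel_le Suc_leI less_imp_le_nat)+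
      then show "block_lengths p q (J + c) n ! i = block_lengths p q J n ! i"
        using i long_window[OF pq det ac(2), of "J + i"] long_window[OF pq det ac(2), of "Suc (J + i)"]
        by (simp add: nth_block_lengths ac_simps)
    qed simp
    with shift_c show False ..
  qed
  then obtain z where z: "J \<le> z" "z \<le> J + n" "q dvd z" by blast
  show ?thesis
  proof (cases "y < z")
    case True
    have "y + a \<le> z"
    proof (rule ccontr)
      assume "\<not> y + a \<le> z"
      then have "q dvd (y + a) - z" "0 < y + a - z" "y + a - z < q"
        using y(3) z(3) True pq ac by (auto intro: dvd_diff_nat)
      then show False by (auto dest: dvd_imp_le)
    qed
    then show ?thesis using y z by (intro disjI1 exI[of _ y]) auto
  next
    case False
    have "z + c \<le> y"
    proof (rule ccontr)
      assume "\<not> z + c \<le> y"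
      then have "q dvd (y + a) - z" "0 < y + a - z" "y + a - z < q"
        using y(3) z(3) False pq ac by (auto intro: dvd_diff_nat)
      then show False by (auto dest: dvd_imp_le)
    qed
    then show ?thesis using y z by (intro disjI2 exI[of _ z]) auto
  qed
qed

text \<open>A factor that reappears after \<open>e\<close> places, \<open>0 < e < q\<close>, also reappears after \<open>q\<close> places, and so
  occurs at least three times in a double period.\<close>

lemma repeated_block_lengths_not_twice:
  assumes q: "0 < q" and e: "0 < e" "e < q"
    and eq: "block_lengths p q (J + e) n = block_lengths p q J n"
  shows "card (cyclic_occurrences (block_lengths p q J n) (block_lengths p q J (2 * q))) \<noteq> 2"
proof -
  let ?g = "\<lambda>i. block_start p q (Suc i) - block_start p q i"
  have g: "?g (i + k * q) = ?g i" for i k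
    using block_start_period[OF q, of p i k] block_start_period[OF q, of p "Suc i" k] by simp
  have occ: "i \<in> cyclic_occurrences (block_lengths p q J n) (block_lengths p q J (2 * q))"
    if i: "i < 2 * q" and match: "\<And>j. j < n \<Longrightarrow> ?g (J + i + j) = ?g (J + j)" for i
  proof -
    have "block_lengths p q J (2 * q) ! ((i + j) mod (2 * q)) = block_lengths p q J n ! j"
      if j: "j < n" for j
    proof -
      have "block_lengths p q J (2 * q) ! ((i + j) mod (2 * q)) = ?g (J + (i + j) mod (2 * q))"
        using q by (simp add: nth_block_lengths)
      also have "\<dots> = ?g ((J + (i + j) mod (2 * q)) + (2 * ((i + j) div (2 * q))) * q)"
        by (rule g[symmetric])
      also have "(J + (i + j) mod (2 * q)) + (2 * ((i + j) div (2 * q))) * q = J + i + j"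
        using mod_mult_div_eq[of "i + j" "2 * q"] by (simp only: ac_simps)
      finally show ?thesis using match[OF j] j by (simp add: nth_block_lengths)
    qed
    then show ?thesis using i by (simp add: cyclic_occurrences_def)
  qed
  have "?g (J + e + j) = ?g (J + j)" if "j < n" for j
    using arg_cong[OF eq, of "\<lambda>xs. xs ! j"] that by (simp add: nth_block_lengths)
  moreover have "?g (J + q + j) = ?g (J + j)" for j using g[of "J + j" 1] by (simp add: ac_simps)
  ultimately have "{0, e, q} \<subseteq> cyclic_occurrences (block_lengths p q J n) (block_lengths p q J (2 * q))"
    using occ[of 0] occ[of e] occ[of q] e by auto
  then have "card {0, e, q} \<le> card (cyclic_occurrences (block_lengths p q J n) (block_lengths p q J (2 * q)))"
    by (rule card_mono[rotated]) (simp add: cyclic_occurrences_def)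
  moreover have "card {0, e, q} = 3" using e by simp
  ultimately show ?thesis by linarith
qed

section \<open>Windows in decompositions and the comparison of slopes\<close>

text \<open>A factor is remembered only through its length and its sum: this is what survives the
  passage from \<open>CS r\<close> to \<open>CS s\<close>.\<close>

definition has_window :: "nat list \<Rightarrow> nat \<Rightarrow> nat \<Rightarrow> bool" where
  "has_window xs n \<sigma> \<longleftrightarrow> (\<exists>ys. sublist ys xs \<and> length ys = n \<and> sum_list ys = \<sigma>)"

lemma has_window_mono: "has_window xs n \<sigma> \<Longrightarrow> sublist xs zs \<Longrightarrow> has_window zs n \<sigma>"
  unfolding has_window_def using sublist_order.order.trans by blast

text \<open>Both \<open>X\<close> and \<open>Y\<close> contain an exceptional window.  These cannot be of the same kind, because
  exceptional windows of the same kind are a multiple of \<open>q\<close> apart, whereas \<open>X\<close> and \<open>Y\<close>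
  together only have length \<open>q\<close>.\<close>

lemma decomposition_windows:
  fixes a b c d p q :: nat
  assumes r: "0 < r" "r \<le> 1" and r_eq: "rat_num r = q" "rat_den r = p"
    and pq: "q = a + c" "p = b + d" and det: "b * c = a * d + 1" and ac: "0 < a" "0 < c"
    and CS: "CS r = cyclic (X @ Y @ X @ Y)"
    and occ: "occurs_exactly 2 X (CS r)" "occurs_exactly 2 Y (CS r)"
  shows "has_window (X @ Y) a (b - 1)" "has_window (X @ Y) c (d + 1)"
    and "has_window (Y @ X) a (b - 1)" "has_window (Y @ X) c (d + 1)"
proof -
  let ?B = "block_lengths p q"
  have q: "0 < q" using pq ac by simp
  have inXY: "X @ Y @ X @ Y \<in> CS r" by (auto simp: CS cyclic_def intro: exI[of _ 0])
  then obtain J where J: "X @ Y @ X @ Y = ?B J (2 * q)"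
    using CS_eq_block_lengths[OF r] r_eq by metis
  define n where "n = length X"
  define k where "k = length Y"
  have nk: "n + k = q"
    using arg_cong[OF J, of length] by (simp add: n_def k_def)
  have "?B J (2 * q) = ?B J (n + (k + q))" using nk by (intro arg_cong[of _ _ "?B J"]) linarith
  also have "\<dots> = ?B J n @ ?B (J + n) k @ ?B (J + q) q"
    by (simp only: block_lengths_append nk[symmetric] add.assoc)
  finally have XY: "X = ?B J n" "Y = ?B (J + n) k"
    using J by (auto simp: n_def k_def append_eq_append_conv)
  have rot: "rotate n (X @ Y @ X @ Y) = Y @ X @ Y @ X"
    using rotate_append[of X "Y @ X @ Y"] by (simp add: n_def)
  then have inYX: "Y @ X @ Y @ X \<in> CS r" by (auto simp: CS cyclic_def intro: exI[of _ n])
  have shift: "?B (i + q) l = ?B i l" for i l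
  proof (rule nth_equalityI)
    fix j assume "j < length (?B (i + q) l)"
    moreover have "i + q + j = i + j + 1 * q" "Suc (i + q + j) = Suc (i + j) + 1 * q" by simp_all
    ultimately show "?B (i + q) l ! j = ?B i l ! j"
      by (simp only: nth_block_lengths length_block_lengths block_start_period[OF q])
  qed simp
  have "?B (J + n) (2 * q) = ?B (J + n) (k + (n + (k + n)))"
    using nk by (intro arg_cong[of _ _ "?B (J + n)"]) linarith
  also have "\<dots> = ?B (J + n) k @ ?B (J + q) n @ ?B ((J + n) + q) k @ ?B ((J + q) + q) n"
  proof -
    have "J + n + k = J + q" "J + q + n = J + n + q" "J + n + q + k = J + q + q" using nk by simp_all
    then show ?thesis by (simp only: block_lengths_append)
  qed
  also have "\<dots> = Y @ X @ Y @ X" by (simp only: shift XY[symmetric])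
  finally have J': "Y @ X @ Y @ X = ?B (J + n) (2 * q)" ..
  have eq_ne: "block_lengths p q (I + e) l \<noteq> block_lengths p q I l"
    if "card (cyclic_occurrences (?B I l) (?B I (2 * q))) = 2" "e = a \<or> e = c" for I l e
    using repeated_block_lengths_not_twice[OF q, of e p I l] that pq ac by auto
  have "card (cyclic_occurrences (?B J n) (?B J (2 * q))) = 2"
    using occ(1) inXY by (simp only: occurs_exactly_def flip: J XY)
  then have one: "(\<exists>y. J \<le> y \<and> y + a \<le> J + n \<and> q dvd y + a) \<or> (\<exists>z. J \<le> z \<and> z + c \<le> J + n \<and> q dvd z)"
    by (intro unrepeated_contains_window[OF pq det ac]) (auto dest: eq_ne)
  have "card (cyclic_occurrences (?B (J + n) k) (?B (J + n) (2 * q))) = 2"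
    using occ(2) inYX by (simp only: occurs_exactly_def flip: J' XY)
  then have two: "(\<exists>y. J + n \<le> y \<and> y + a \<le> J + n + k \<and> q dvd y + a) \<or>
      (\<exists>z. J + n \<le> z \<and> z + c \<le> J + n + k \<and> q dvd z)"
    by (intro unrepeated_contains_window[OF pq det ac]) (auto dest: eq_ne)
  have apart: "q \<le> y' - y" if "q dvd y" "q dvd y'" "y < y'" for y y'
    using that dvd_diff_nat[of q y' y] by (simp add: dvd_imp_le)
  have wa: "has_window (?B I l) a (b - 1)" if "I \<le> y" "y + a \<le> I + l" "q dvd y + a" for I l y
    unfolding has_window_def
  proof (intro exI conjI)
    show "sublist (?B y a) (?B I l)" using that by (intro sublist_block_lengthsI)
    show "sum_list (?B y a) = b - 1"
      using short_window[OF pq det ac(2), of y] that(3) by (simp add: sum_list_block_lengths)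
  qed simp
  have wc: "has_window (?B I l) c (d + 1)" if "I \<le> z" "z + c \<le> I + l" "q dvd z" for I l z
    unfolding has_window_def
  proof (intro exI conjI)
    show "sublist (?B z c) (?B I l)" using that by (intro sublist_block_lengthsI)
    show "sum_list (?B z c) = d + 1"
      using long_window[OF pq det ac(2), of z] that(3) by (simp add: sum_list_block_lengths)
  qed simp
  have "has_window X a (b - 1) \<and> has_window Y c (d + 1) \<or> has_window X c (d + 1) \<and> has_window Y a (b - 1)"
    using one
  proof
    assume "\<exists>y. J \<le> y \<and> y + a \<le> J + n \<and> q dvd y + a"
    then obtain y where y: "J \<le> y" "y + a \<le> J + n" "q dvd y + a" by blast
    have "\<not> (J + n \<le> y' \<and> y' + a \<le> J + n + k \<and> q dvd y' + a)" for y'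
      using apart[of "y + a" "y' + a"] y ac nk by auto
    then show ?thesis using two wa[OF y] wc XY by metis
  next
    assume "\<exists>z. J \<le> z \<and> z + c \<le> J + n \<and> q dvd z"
    then obtain z where z: "J \<le> z" "z + c \<le> J + n" "q dvd z" by blast
    have "\<not> (J + n \<le> z' \<and> z' + c \<le> J + n + k \<and> q dvd z')" for z'
      using apart[of z z'] z ac nk by auto
    then show ?thesis using two wc[OF z] wa XY by metis
  qed
  then show "has_window (X @ Y) a (b - 1)" "has_window (X @ Y) c (d + 1)"
    and "has_window (Y @ X) a (b - 1)" "has_window (Y @ X) c (d + 1)"
    by (meson has_window_mono sublist_append_leftI sublist_append_rightI)+
qed

text \<open>The sum is \<open>h(K + n) - h(K)\<close> for the slope \<open>s\<close>, and rounding up changes each of \<open>(K + n)/s\<close> and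
  \<open>K/s\<close> by less than \<open>1\<close>.  Both estimates are multiplied by \<open>s\<close> here.\<close>

lemma window_bounds:
  assumes s: "0 < s" "s \<le> 1" and xs: "xs \<in> CS s" "has_window xs n \<sigma>"
  shows "s * of_nat \<sigma> < of_nat n + s" "of_nat n < s * of_nat (\<sigma> + 1)"
proof -
  define p where "p = rat_den s"
  define q where "q = rat_num s"
  have q: "0 < q" "q \<le> p" and s_eq: "s = of_nat q / of_nat p"
    using rat_num_den[OF s] by (auto simp: p_def q_def)
  obtain J where J: "xs = block_lengths p q J (2 * q)"
    using CS_eq_block_lengths[OF s xs(1)] by (auto simp: p_def q_def)
  obtain ys where ys: "sublist ys xs" "length ys = n" "sum_list ys = \<sigma>"
    using xs(2) by (auto simp: has_window_def)
  obtain K where K: "ys = block_lengths p q K n" using sublist_block_lengths ys J by metis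
  have "block_start p q K \<le> block_start p q (K + n)" by (rule block_start_mono) simp
  then have \<sigma>: "block_start p q (K + n) = block_start p q K + \<sigma>"
    using ys(3) by (simp add: K sum_list_block_lengths)
  have "q * \<sigma> < n * p + q" "n * p < q * (\<sigma> + 1)"
    using block_start_bounds[OF q(1), where p=p and j=K] block_start_bounds[OF q(1), where p=p and j="K+n"]
    unfolding \<sigma> by (simp_all add: algebra_simps)
  then have "rat_of_nat (q * \<sigma>) < rat_of_nat (n * p + q)" "rat_of_nat (n * p) < rat_of_nat (q * (\<sigma> + 1))"
    by (simp_all only: of_nat_less_iff)
  then show "s * of_nat \<sigma> < of_nat n + s" "of_nat n < s * of_nat (\<sigma> + 1)"
    using q by (simp_all add: s_eq field_simps)
qed

theorem lemma5p1:
  fixes r s :: rat and m l :: "nat list" and k t :: nat and S1 S2 :: "nat list"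
  assumes r: "0 < r" "r < 1"
    and m: "cfrac_expansion r m" "k = length m"
    and decomposition: "CS r = cyclic (S1 @ S2 @ S1 @ S2)"
    and a: "rev S1 = S1" "rev S2 = S2" "k = 1 \<longrightarrow> S1 = []"
    and b: "k \<noteq> 1 \<longrightarrow> occurs_exactly 2 S1 (CS r)" "occurs_exactly 2 S2 (CS r)"
    and c: "k \<noteq> 1 \<longrightarrow> S1 \<noteq> [] \<and> hd S1 = m ! 0 + 1 \<and> last S1 = m ! 0 + 1"
    and d: "S2 \<noteq> [] \<and> hd S2 = m ! 0 \<and> last S2 = m ! 0"
    and s: "0 < s" "s \<le> 1"
    and l: "cfrac_expansion s l" "t = length l"
    and i: "k = 1 \<longrightarrow> (\<exists>xs \<in> CS s. \<exists>x \<in> set xs. x \<ge> m ! 0)"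
    and ii: "k \<ge> 2 \<longrightarrow> cyclic_contains (CS s) (S1 @ S2) \<or> cyclic_contains (CS s) (S2 @ S1)"
  shows "t \<ge> k \<and>
         (\<forall>i \<in> {1..k - 1}. l ! (i - 1) = m ! (i - 1)) \<and>
         (l ! (k - 1) \<ge> m ! (k - 1) \<or> (l ! (k - 1) = m ! (k - 1) - 1 \<and> t > k))"
proof -
  have m_pos: "m \<noteq> []" "\<forall>x \<in> set m. 0 < x" and r_eq: "r = cfrac m"
    using m by (auto simp: cfrac_expansion_def)
  have m_last: "2 \<le> last m"
  proof (cases "length m = 1")
    case True
    then obtain x where "m = [x]" by (cases m) auto
    then show ?thesis using r r_eq m_pos by (cases "x = 1") auto
  qed (use m in \<open>auto simp: cfrac_expansion_def\<close>)
  have "strictly_between (cfrac (butlast m)) (cfrac (butlast m @ [last m - 1])) s"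
  proof (cases "k = 1")
    case True
    then obtain x where x: "m = [x]" using m by (cases m) auto
    then have x2: "2 \<le> x" using m_last by simp
    obtain xs z where z: "xs \<in> CS s" "z \<in> set xs" "x \<le> z" using i True x by auto
    then obtain us vs where "xs = us @ [z] @ vs" by (auto dest: split_list)
    then have window: "has_window xs 1 z" unfolding has_window_def
      using sublist_appendI[of "[z]" us vs] by (intro exI[of _ "[z]"]) simp
    have "s * of_nat z < 1 + s" using window_bounds(1)[OF s z(1) window] by simp
    moreover have "s * of_nat x \<le> s * of_nat z" using s z(3) by simp
    ultimately have "s * of_nat (x - 1) < 1" using x2 by (simp add: of_nat_diff algebra_simps)
    then have "s < 1 / of_nat (x - 1)" using x2 by (simp add: field_simps)
    then show ?thesis using s x2 by (simp add: x strictly_between_def of_nat_diff)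
  next
    case False
    then have k: "2 \<le> k" using m m_pos by (cases m) (auto simp: Suc_le_eq)
    have key: "strictly_between (of_nat a / of_nat b) (of_nat c / of_nat d) s"
      if pos: "0 < a" "0 < b" "0 < c" "0 < d" and rr: "r = of_nat (a + c) / of_nat (b + d)"
        and det: "b * c = a * d + 1" for a b c d :: nat
    proof -
      have cop: "coprime (a + c) (b + d)" by (rule farey_coprime[OF det])
      have rn: "rat_num r = a + c" "rat_den r = b + d"
        using rat_num_den_unique[OF rr cop] pos by auto
      have "r \<le> 1" using r by simp
      note w = decomposition_windows[OF r(1) this rn refl refl det pos(1,3) decomposition]
      from ii k obtain xs T where T: "T = S1 @ S2 \<or> T = S2 @ S1" "xs \<in> CS s" "sublist T xs"
        by (auto simp: cyclic_contains_def)
      have "has_window T a (b - 1)" "has_window T c (d + 1)" using w b False T(1) by auto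
      then have "has_window xs a (b - 1)" "has_window xs c (d + 1)"
        using has_window_mono[OF _ T(3)] by blast+
      then have "of_nat a < s * of_nat (b - 1 + 1)" "s * of_nat (d + 1) < of_nat c + s"
        using window_bounds(2)[OF s T(2), of a "b - 1"] window_bounds(1)[OF s T(2), of c "d + 1"]
        by blast+
      then have "of_nat a < s * of_nat b" "s * of_nat d < of_nat c"
        using pos by (simp_all add: algebra_simps)
      then show ?thesis using pos by (simp add: strictly_between_def field_simps)
    qed
    obtain a b c d :: nat where f: "0 < b" "0 < c" "0 < d" "length m \<ge> 2 \<longrightarrow> 0 < a"
      "cfrac (butlast m) = of_nat a / of_nat b"
      "cfrac (butlast m @ [last m - 1]) = of_nat c / of_nat d"
      "cfrac m = of_nat (a + c) / of_nat (b + d)"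
      "b * c = a * d + 1 \<or> a * d = b * c + 1"
      using cfrac_farey_parents[OF m_pos m_last] by (elim exE conjE)
    have a: "0 < a" using f(4) k m by simp
    from f(8) show ?thesis
    proof
      assume "b * c = a * d + 1"
      from key[OF a f(1-3) r_eq[unfolded f(7)] this] show ?thesis by (simp only: f(5,6))
    next
      assume "a * d = b * c + 1"
      then have det: "d * a = c * b + 1" by (simp only: mult.commute)
      have "r = of_nat (c + a) / of_nat (d + b)" by (simp only: r_eq f(7) add.commute)
      from key[OF f(2,3) a f(1) this det] show ?thesis
        unfolding f(5,6) by (auto simp: strictly_between_def)
    qed
  qed
  then have "length m \<le> length l \<and> (\<forall>i < length m - 1. l ! i = m ! i) \<and>
    (m ! (length m - 1) \<le> l ! (length m - 1) \<or>
     l ! (length m - 1) = m ! (length m - 1) - 1 \<and> length m < length l)"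
    using l by (intro between_farey_parents[OF m_pos m_last]) (auto simp: cfrac_expansion_def)
  moreover have "i - 1 < length m - 1" if "i \<in> {1..length m - 1}" for i using that by auto
  ultimately show ?thesis unfolding m(2) l(2) by blast
qed

end
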